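(* For real $q,r>0$ define $\Omega^{(q,r)}:\mathbb{R}\to\mathbb{R}$ by $\Omega^{(q,r)}(x) := \frac{qr(e^{-qx}-e^{-rx})}{r-q}$ if $x>0$ and $q\ne r$; $\Omega^{(q,r)}(x) := r^2 x e^{-rx}$ if $x>0$ and $q = r$; and $\Omega^{(q,r)}(x) := 0$ if $x \le 0$. Fix an integer $p \geq 2$, subsets $X,Y\subset\mathbb{R}$ each of size at least $p$, and $q,r>0$. \begin{enumerate} \item If $\alpha \geq p-2$, then the kernel $(x,y)\mapsto \Omega^{(q,r)}(x-y)^\alpha$ is $\mathrm{TN}_p$ on $X\times Y$. \item There exists $a = a(X,Y)\in\mathbb{R}$ such that for every $\alpha\in(0,p-2)\setminus\mathbb{Z}$ the kernel $(x,y)\mapsto\Omega^{(q,r)}(x-y-a)^\alpha$ on $X\times Y$ is not $\mathrm{TN}_p$. \item Given $\mathbf{x},\mathbf{y}\in\operatorname{inc}(\mathbb{R},p)$, there exists $a\in\mathbb{R}$ such that for every $\alpha \ge 0$ the matrix $(\Omega^{(q,r)}(x_j-y_k-a)^\alpha)_{j,k=1}^p$ is $\mathrm{TP}$ if $\alpha>p-2$, $\mathrm{TN}$ if $\alpha\in\{0,1,\dots,p-2\}$, and not $\mathrm{TN}$ if $\alpha\in(0,p-2)\setminus\mathbb{Z}$. \end{enumerate}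
   Context: For a totally ordered set $X$ and integer $r \geq 1$, $\operatorname{inc}(X,r)$ denotes the set of $r$-tuples $(x_1,\dots,x_r) \in X^r$ with $x_1 < \cdots < x_r$. For $X,Y \subset \mathbb{R}$, a kernel $K : X \times Y \to \mathbb{R}$ is $\mathrm{TN}_p$ if $\det (K(x_j,y_k))_{j,k=1}^r \geq 0$ for all $1 \leq r \leq p$ and all $\mathbf{x} \in \operatorname{inc}(X,r)$, $\mathbf{y} \in \operatorname{inc}(Y,r)$. A real matrix is $\mathrm{TN}$/$\mathrm{TP}$ if all its minors are $\ge0$/$>0$. Convention: $0^0:=0$. *)

theory Defs
  imports Complex_Main "Jordan_Normal_Form.Determinant"
begin

definition Omega :: "real \<Rightarrow> real \<Rightarrow> real \<Rightarrow> real" where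
  "Omega q r x =
     (if x > 0 then (if q \<noteq> r then q * r * (exp (- q * x) - exp (- r * x)) / (r - q)
                     else r ^ 2 * x * exp (- r * x))
      else 0)"

definition inc :: "real set \<Rightarrow> nat \<Rightarrow> real list set" where
  "inc X r = {xs. length xs = r \<and> set xs \<subseteq> X \<and> sorted_wrt (<) xs}"

definition kmat :: "(real \<Rightarrow> real \<Rightarrow> real) \<Rightarrow> real list \<Rightarrow> real list \<Rightarrow> real mat" where
  "kmat K xs ys = mat (length xs) (length ys) (\<lambda>(j, k). K (xs ! j) (ys ! k))"

definition TN_kernel :: "nat \<Rightarrow> (real \<Rightarrow> real \<Rightarrow> real) \<Rightarrow> real set \<Rightarrow> real set \<Rightarrow> bool" where
  "TN_kernel p K X Y =
     (\<forall>r\<in>{1..p}. \<forall>xs\<in>inc X r. \<forall>ys\<in>inc Y r. det (kmat K xs ys) \<ge> 0)"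

definition minor :: "real mat \<Rightarrow> nat list \<Rightarrow> nat list \<Rightarrow> real" where
  "minor A is js = det (mat (length is) (length js) (\<lambda>(a, b). A $$ (is ! a, js ! b)))"

definition index_lists :: "nat \<Rightarrow> nat \<Rightarrow> nat list set" where
  "index_lists n r = {is. length is = r \<and> set is \<subseteq> {..<n} \<and> sorted_wrt (<) is}"

definition TN_mat :: "real mat \<Rightarrow> bool" where
  "TN_mat A = (\<forall>r\<ge>1. \<forall>is\<in>index_lists (dim_row A) r. \<forall>js\<in>index_lists (dim_col A) r.
                  minor A is js \<ge> 0)"

definition TP_mat :: "real mat \<Rightarrow> bool" where
  "TP_mat A = (\<forall>r\<ge>1. \<forall>is\<in>index_lists (dim_row A) r. \<forall>js\<in>index_lists (dim_col A) r.
                  minor A is js > 0)"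

end

(* Up to positive row and column factors, Omega^(q,r)(s - t) = max (f s - f t) 0 with f strictly
   increasing, so everything reduces to determinants of (u_i - v_j)_+ ^ alpha.
   Divide the rows of such a determinant by its first column, take differences of consecutive rows,
   and apply the mean value theorem to one row at a time: the determinant of order n + 1 becomes a
   positive multiple of alpha^n times a determinant of order n with exponent alpha - 1 and nodes
   t_i in (u_i, u_(i+1)).  When all u_i exceed all v_j, iterating gives the sign
   prod_(i<n) sgn(alpha - i)^(n-1-i) of a determinant of order n, hence the last two parts once the
   shift has separated the points.  Without separation the recursion needs alpha > 1 for
   differentiability; it then yields nonnegativity for alpha > n - 2 and, letting the exponent
   decrease to n - 2, for alpha = n - 2. *)
theory Submission
  imports Defs
begin

section \<open>Determinant identities: scaling, differences of rows, mean values\<close>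

lemma det_scale:
  fixes M :: "nat \<Rightarrow> nat \<Rightarrow> real"
  shows "det (mat n n (\<lambda>(i, j). a i * b j * M i j))
       = (\<Prod>i<n. a i) * (\<Prod>j<n. b j) * det (mat n n (\<lambda>(i, j). M i j))"
proof -
  let ?M = "mat n n (\<lambda>(i, j). M i j)"
  have "mat n n (\<lambda>(i, j). a i * b j * M i j) = mat_diag n a * (?M * mat_diag n b)"
    by (subst mat_diag_mult_right[of _ n], simp, subst mat_diag_mult_left[of _ n n], simp)
       (auto intro!: eq_matI)
  moreover have "det (mat_diag n f) = (\<Prod>i<n. f i)" for f :: "nat \<Rightarrow> real"
    by (subst det_upper_triangular[of _ n])
       (auto simp: upper_triangular_def mat_diag_def prod_list_diag_prod atLeast0LessThan)
  ultimately show ?thesis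
    by (simp add: det_mult[of _ n] mult_carrier_mat[of _ n n])
qed

text \<open>A unipotent bidiagonal matrix \<open>L\<close> multiplied from the left subtracts from
  each row its predecessor. The first column becomes the first unit vector, so Laplace expansion
  leaves a single cofactor.\<close>

lemma det_first_column_ones:
  fixes g :: "nat \<Rightarrow> nat \<Rightarrow> real"
  assumes "\<And>i. i \<le> n \<Longrightarrow> g i 0 = 1"
  shows "det (mat (Suc n) (Suc n) (\<lambda>(i, j). g i j))
       = det (mat n n (\<lambda>(i, j). g (Suc i) (Suc j) - g i (Suc j)))"
proof -
  let ?A = "mat (Suc n) (Suc n) (\<lambda>(i, j). g i j)"
  define L :: "real mat" where
    "L = mat (Suc n) (Suc n) (\<lambda>(i, j). if i = j then 1 else if i = Suc j then - 1 else 0)"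
  have L: "L \<in> carrier_mat (Suc n) (Suc n)"
    by (simp add: L_def)
  have detL: "det L = 1"
    by (subst det_lower_triangular[OF _ L]) (auto simp: L_def prod_list_diag_prod)
  have LA: "(L * ?A) $$ (i, j) = (if i = 0 then g 0 j else g i j - g (i - 1) j)"
    if "i < Suc n" "j < Suc n" for i j
  proof -
    have "(L * ?A) $$ (i, j)
        = (\<Sum>k<Suc n. (if i = k then 1 else if i = Suc k then - 1 else 0) * g k j)"
      using that by (auto simp: L_def scalar_prod_def atLeast0LessThan intro!: sum.cong)
    \<comment> \<open>The subdiagonal condition is solved for \<open>k\<close>, so each indicator
      sum collapses to one term. The guard \<open>i \<noteq> 0\<close> matters because
      \<open>0 - 1 = 0\<close> on naturals.\<close>
    also have "\<dots> = (\<Sum>k<Suc n. (if i = k then g k j else 0) - (if k = i - 1 \<and> i \<noteq> 0 then g k j else 0))"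
      by (intro sum.cong) auto
    also have "\<dots> = g i j - (if i \<noteq> 0 then g (i - 1) j else 0)"
      using that by (cases "i = 0") (auto simp: sum_subtractf simp del: sum.lessThan_Suc)
    finally show ?thesis by simp
  qed
  have "det ?A = det (L * ?A)"
    using L detL by (simp add: det_mult[of _ "Suc n"])
  also have "\<dots> = (\<Sum>i<Suc n. (L * ?A) $$ (i, 0) * cofactor (L * ?A) i 0)"
    using L by (intro laplace_expansion_column) auto
  also have "\<dots> = (\<Sum>i<Suc n. if i = 0 then cofactor (L * ?A) 0 0 else 0)"
    by (intro sum.cong refl) (auto simp: LA assms simp del: index_mult_mat)
  also have "\<dots> = det (mat_delete (L * ?A) 0 0)"
    by (simp add: cofactor_def)
  also have "mat_delete (L * ?A) 0 0 = mat n n (\<lambda>(i, j). g (Suc i) (Suc j) - g i (Suc j))"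
    using L by (intro eq_matI) (auto simp: mat_delete_def LA simp del: index_mult_mat(1))
  finally show ?thesis .
qed

text \<open>The cofactors along row \<open>m\<close> do not involve row \<open>m\<close>, so they
  can be computed with that row set to zero. The determinant is thus linear in the row with fixed
  coefficients, and can be differentiated when the row depends on a real variable.\<close>

lemma det_row_combination:
  fixes h :: "nat \<Rightarrow> nat \<Rightarrow> real"
  assumes "m < n"
  obtains c where "\<And>x. det (mat n n (\<lambda>(i, k). if i = m then x k else h i k)) = (\<Sum>k<n. x k * c k)"
proof
  fix x :: "nat \<Rightarrow> real"
  let ?A = "\<lambda>x. mat n n (\<lambda>(i, k). if i = m then x k else h i k)"
  have "det (?A x) = (\<Sum>k<n. ?A x $$ (m, k) * cofactor (?A x) m k)"
    using assms by (intro laplace_expansion_row) auto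
  also have "\<dots> = (\<Sum>k<n. x k * cofactor (?A (\<lambda>_. 0)) m k)"
  proof (intro sum.cong refl)
    fix k assume k: "k \<in> {..<n}"
    have "mat_delete (?A x) m k = mat_delete (?A (\<lambda>_. 0)) m k"
      using assms k by (intro eq_matI) (auto simp: mat_delete_def)
    then show "?A x $$ (m, k) * cofactor (?A x) m k = x k * cofactor (?A (\<lambda>_. 0)) m k"
      using assms k by (simp add: cofactor_def)
  qed
  finally show "det (?A x) = (\<Sum>k<n. x k * cofactor (?A (\<lambda>_. 0)) m k)" .
qed

text \<open>The mean value theorem is applied to the determinant as a scalar function of the
  variable of one row, not to single entries. Hence all entries of row \<open>i\<close> share the
  same intermediate point \<open>t i\<close>.\<close>

lemma det_mean_value_rows:
  fixes g g' :: "nat \<Rightarrow> real \<Rightarrow> real" and a b :: "nat \<Rightarrow> real"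
  assumes ab: "\<And>i. i < n \<Longrightarrow> a i < b i"
    and der: "\<And>i k x. \<lbrakk>i < n; k < n; a i \<le> x; x \<le> b i\<rbrakk> \<Longrightarrow> (g k has_real_derivative g' k x) (at x)"
  shows "\<exists>t. (\<forall>i<n. a i < t i \<and> t i < b i) \<and>
     det (mat n n (\<lambda>(i, k). g k (b i) - g k (a i)))
     = (\<Prod>i<n. b i - a i) * det (mat n n (\<lambda>(i, k). g' k (t i)))"
proof -
  \<comment> \<open>Induction on the number \<open>m\<close> of rows treated: rows before
    \<open>m\<close> carry derivatives, the others still carry increments.\<close>
  have "\<exists>t. (\<forall>i<m. a i < t i \<and> t i < b i) \<and>
     det (mat n n (\<lambda>(i, k). g k (b i) - g k (a i)))
     = (\<Prod>i<m. b i - a i) *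
       det (mat n n (\<lambda>(i, k). if i < m then g' k (t i) else g k (b i) - g k (a i)))"
    if "m \<le> n" for m
    using that
  proof (induction m)
    case 0
    then show ?case by simp
  next
    case (Suc m)
    then have m: "m < n" by simp
    obtain t where t: "\<forall>i<m. a i < t i \<and> t i < b i"
      and eq: "det (mat n n (\<lambda>(i, k). g k (b i) - g k (a i))) = (\<Prod>i<m. b i - a i) *
        det (mat n n (\<lambda>(i, k). if i < m then g' k (t i) else g k (b i) - g k (a i)))"
      using Suc by auto
    define h where "h i k = (if i < m then g' k (t i) else g k (b i) - g k (a i))" for i k
    obtain c where c: "\<And>x. det (mat n n (\<lambda>(i, k). if i = m then x k else h i k))
        = (\<Sum>k<n. x k * c k)"
      using det_row_combination[OF m, of h] by blast
    \<comment> \<open>\<open>F x\<close> is the determinant with row \<open>m\<close> equal to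
      \<open>g k x\<close>. By linearity its increment is the determinant with increments in row
      \<open>m\<close>, and its derivative the one with \<open>g' k x\<close> there.\<close>
    define F where "F x = (\<Sum>k<n. g k x * c k)" for x
    have "(F has_real_derivative (\<Sum>k<n. g' k x * c k)) (at x)" if "a m \<le> x" "x \<le> b m" for x
      unfolding F_def by (intro DERIV_sum DERIV_cmult_right der) (use m that in auto)
    then obtain z where z: "a m < z" "z < b m"
      and Fz: "F (b m) - F (a m) = (b m - a m) * (\<Sum>k<n. g' k z * c k)"
      using MVT2[OF ab[OF m], of F "\<lambda>x. \<Sum>k<n. g' k x * c k"] by blast
    have "mat n n (\<lambda>(i, k). if i < m then g' k (t i) else g k (b i) - g k (a i))
        = mat n n (\<lambda>(i, k). if i = m then g k (b m) - g k (a m) else h i k)"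
      by (intro eq_matI) (auto simp: h_def)
    then have "det (mat n n (\<lambda>(i, k). if i < m then g' k (t i) else g k (b i) - g k (a i)))
        = F (b m) - F (a m)"
      by (simp add: c F_def left_diff_distrib sum_subtractf)
    also have "\<dots> = (b m - a m) * det (mat n n (\<lambda>(i, k). if i = m then g' k z else h i k))"
      by (simp add: Fz c)
    also have "mat n n (\<lambda>(i, k). if i = m then g' k z else h i k)
       = mat n n (\<lambda>(i, k). if i < Suc m then g' k ((t(m := z)) i) else g k (b i) - g k (a i))"
      by (intro eq_matI) (auto simp: h_def)
    finally have "det (mat n n (\<lambda>(i, k). g k (b i) - g k (a i))) = (\<Prod>i<Suc m. b i - a i) *
      det (mat n n (\<lambda>(i, k). if i < Suc m then g' k ((t(m := z)) i) else g k (b i) - g k (a i)))"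
      using eq by simp
    moreover have "\<forall>i<Suc m. a i < (t(m := z)) i \<and> (t(m := z)) i < b i"
      using t z by (auto simp: less_Suc_eq)
    ultimately show ?case by blast
  qed
  from this[of n] obtain t where t: "\<forall>i<n. a i < t i \<and> t i < b i"
    and eq: "det (mat n n (\<lambda>(i, k). g k (b i) - g k (a i))) = (\<Prod>i<n. b i - a i) *
       det (mat n n (\<lambda>(i, k). if i < n then g' k (t i) else g k (b i) - g k (a i)))"
    by auto
  have "mat n n (\<lambda>(i, k). if i < n then g' k (t i) else g k (b i) - g k (a i))
      = mat n n (\<lambda>(i, k). g' k (t i))"
    by (intro eq_matI) auto
  with t eq show ?thesis by metis
qed

section \<open>Truncated powers and the recursion for their determinants\<close>

lemma DERIV_truncated_powr:
  fixes \<alpha> v x :: real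
  assumes "\<alpha> > 1 \<or> x > v"
  shows "((\<lambda>x. max (x - v) 0 powr \<alpha>) has_real_derivative \<alpha> * max (x - v) 0 powr (\<alpha> - 1)) (at x)"
proof -
  consider "x > v" | "x < v" | "x = v" "\<alpha> > 1"
    using assms by linarith
  then show ?thesis
  proof cases
    case 1
    have "((\<lambda>x. (x - v) powr \<alpha>) has_real_derivative \<alpha> * (x - v) powr (\<alpha> - 1)) (at x)"
      using 1 by (auto intro!: derivative_eq_intros)
    moreover have "\<forall>\<^sub>F y in nhds x. max (y - v) 0 powr \<alpha> = (y - v) powr \<alpha>"
      using eventually_nhds_in_open[of "{v<..}" x] 1 by (auto elim!: eventually_mono)
    ultimately show ?thesis
      using 1 by (subst DERIV_cong_ev[OF refl _ refl]) auto
  next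
    case 2
    have "\<forall>\<^sub>F y in nhds x. max (y - v) 0 powr \<alpha> = 0"
      using eventually_nhds_in_open[of "{..<v}" x] 2 by (auto elim!: eventually_mono)
    then have "((\<lambda>x. max (x - v) 0 powr \<alpha>) has_real_derivative 0) (at x)"
      by (subst DERIV_cong_ev[OF refl _ refl, of _ "\<lambda>_. 0"]) auto
    then show ?thesis
      using 2 by simp
  next
    case 3
    \<comment> \<open>This is the difference quotient at the knot. It is dominated by
      \<open>\<bar>h\<bar> powr (\<alpha> - 1)\<close>, which tends to 0 because \<alpha> >
      1.\<close>
    have "((\<lambda>h. max h 0 powr \<alpha> / h) \<longlongrightarrow> 0) (at 0)"
    proof (rule tendsto_0_le)
      have "norm (max h 0 powr \<alpha> / h) \<le> \<bar>h\<bar> powr (\<alpha> - 1)" for h :: real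
        by (cases "h > 0", simp add: powr_diff) (simp add: max.absorb2)
      then show "\<forall>\<^sub>F h in at 0. norm (max h 0 powr \<alpha> / h) \<le> norm (\<bar>h\<bar> powr (\<alpha> - 1)) * 1"
        by simp
      have "((\<lambda>h::real. \<bar>h\<bar> powr (\<alpha> - 1)) \<longlongrightarrow> \<bar>0\<bar> powr (\<alpha> - 1)) (at 0)"
        using 3 by (intro tendsto_powr' tendsto_rabs tendsto_ident_at tendsto_const) auto
      then show "((\<lambda>h::real. \<bar>h\<bar> powr (\<alpha> - 1)) \<longlongrightarrow> 0) (at 0)"
        by simp
    qed
    then show ?thesis
      using 3 by (simp add: DERIV_def)
  qed
qed

text \<open>Since \<open>0 powr \<alpha> = 0\<close> for every \<alpha>, including 0,
  \<open>powr\<close> agrees with the convention that 0 to the power 0 is 0.\<close>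

abbreviation truncated_powr_det :: "real \<Rightarrow> nat \<Rightarrow> (nat \<Rightarrow> real) \<Rightarrow> (nat \<Rightarrow> real) \<Rightarrow> real" where
  "truncated_powr_det \<alpha> n u v \<equiv> det (mat n n (\<lambda>(i, j). max (u i - v j) 0 powr \<alpha>))"

text \<open>Because (x - w) - (x - v) = v - w, the derivative is again a factor depending on
  \<open>x\<close> and \<open>w\<close>, times \<open>v - w\<close>, times a truncated power with
  exponent lowered by one. This product form is what closes the recursion.\<close>

lemma DERIV_truncated_powr_quotient:
  fixes \<alpha> v w x :: real
  assumes "\<alpha> > 1 \<or> x > v" "x > w"
  shows "((\<lambda>x. (x - w) powr (- \<alpha>) * max (x - v) 0 powr \<alpha>) has_real_derivative
     \<alpha> * (x - w) powr (- \<alpha> - 1) * (v - w) * max (x - v) 0 powr (\<alpha> - 1)) (at x)"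
proof -
  let ?m = "max (x - v) 0"
  have "((\<lambda>x. (x - w) powr (- \<alpha>)) has_real_derivative - \<alpha> * (x - w) powr (- \<alpha> - 1)) (at x)"
    using assms(2) by (auto intro!: derivative_eq_intros)
  from DERIV_mult[OF this DERIV_truncated_powr[OF assms(1)]]
  have "((\<lambda>x. (x - w) powr (- \<alpha>) * max (x - v) 0 powr \<alpha>) has_real_derivative
     - \<alpha> * (x - w) powr (- \<alpha> - 1) * ?m powr \<alpha> + \<alpha> * ?m powr (\<alpha> - 1) * (x - w) powr (- \<alpha>)) (at x)"
    by simp
  moreover have "- \<alpha> * (x - w) powr (- \<alpha> - 1) * ?m powr \<alpha> + \<alpha> * ?m powr (\<alpha> - 1) * (x - w) powr (- \<alpha>)
     = \<alpha> * (x - w) powr (- \<alpha> - 1) * (v - w) * ?m powr (\<alpha> - 1)"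
  proof -
    have 1: "(x - w) powr (- \<alpha>) = (x - w) * (x - w) powr (- \<alpha> - 1)"
      using assms(2) by (simp add: powr_diff)
    have "?m powr \<alpha> = ?m * ?m powr (\<alpha> - 1)"
      by (simp add: powr_diff)
    \<comment> \<open>For x \<le> v the remaining power is \<open>0 powr _ = 0\<close>, so dropping
      the truncation in the first factor is harmless.\<close>
    also have "\<dots> = (x - v) * ?m powr (\<alpha> - 1)"
      by (cases "x > v") auto
    finally show ?thesis
      unfolding 1 by (simp only:) (simp add: algebra_simps)
  qed
  ultimately show ?thesis by simp
qed

text \<open>The condition \<open>v 0 < u 0\<close> allows division by the first column. The last
  hypothesis ensures differentiability: either \<alpha> > 1, or all knots lie to the left of all
  nodes. The conclusion \<open>u i < t i\<close> keeps separated nodes separated under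
  iteration.\<close>

lemma truncated_powr_det_Suc:
  fixes \<alpha> :: real and u v :: "nat \<Rightarrow> real"
  assumes u: "strict_mono_on {..<Suc n} u" and v: "strict_mono_on {..<Suc n} v"
    and 0: "v 0 < u 0" and \<alpha>: "\<alpha> > 1 \<or> v n < u 0"
  obtains t C where "C > 0" "strict_mono_on {..<n} t" "\<And>i. i < n \<Longrightarrow> u i < t i"
    "truncated_powr_det \<alpha> (Suc n) u v
       = C * \<alpha> ^ n * truncated_powr_det (\<alpha> - 1) n t (\<lambda>j. v (Suc j))"
proof -
  \<comment> \<open>\<open>g k\<close> is entry \<open>k\<close> of a row divided by entry 0, as a
    function of the node; \<open>g'\<close> is its derivative.\<close>
  define g where "g k x = (x - v 0) powr (- \<alpha>) * max (x - v k) 0 powr \<alpha>" for k x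
  define g' where "g' k x = \<alpha> * (x - v 0) powr (- \<alpha> - 1) * (v k - v 0) * max (x - v k) 0 powr (\<alpha> - 1)"
    for k x
  have u0: "u 0 \<le> u i" if "i \<le> n" for i
    using strict_mono_onD[OF u, of 0 i] that by (cases "i = 0") auto
  have vn: "v k \<le> v n" if "k \<le> n" for k
    using strict_mono_onD[OF v, of k n] that by (cases "k = n") auto
  have uSuc: "u i < u (Suc i)" if "i < n" for i
    using strict_mono_onD[OF u, of i "Suc i"] that by auto
  have pos: "0 < u i - v 0" if "i \<le> n" for i
    using u0[OF that] 0 by linarith
  have powr1: "(u i - v 0) powr \<alpha> * (u i - v 0) powr (- \<alpha>) = 1" if "i \<le> n" for i
    using pos[OF that] by (simp flip: powr_add)
  have "truncated_powr_det \<alpha> (Suc n) u v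
      = det (mat (Suc n) (Suc n) (\<lambda>(i, j). (u i - v 0) powr \<alpha> * 1 * g j (u i)))"
    by (intro arg_cong[of _ _ det] eq_matI)
       (auto simp: g_def powr1 less_Suc_eq_le simp flip: mult.assoc)
  also have "\<dots> = (\<Prod>i<Suc n. (u i - v 0) powr \<alpha>) * det (mat (Suc n) (Suc n) (\<lambda>(i, j). g j (u i)))"
    by (subst det_scale) simp
  also have "det (mat (Suc n) (Suc n) (\<lambda>(i, j). g j (u i)))
      = det (mat n n (\<lambda>(i, j). g (Suc j) (u (Suc i)) - g (Suc j) (u i)))"
    using pos powr1 by (intro det_first_column_ones) (auto simp: g_def mult.commute)
  finally have eq1: "truncated_powr_det \<alpha> (Suc n) u v = (\<Prod>i<Suc n. (u i - v 0) powr \<alpha>) *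
      det (mat n n (\<lambda>(i, j). g (Suc j) (u (Suc i)) - g (Suc j) (u i)))" .
  have der: "(g (Suc k) has_real_derivative g' (Suc k) x) (at x)"
    if "i < n" "k < n" "u i \<le> x" "x \<le> u (Suc i)" for i k x
  proof -
    have "v 0 < x"
      using that u0[of i] 0 by linarith
    moreover have "\<alpha> > 1 \<or> v (Suc k) < x"
      using that u0[of i] \<alpha> vn[of "Suc k"] by fastforce
    ultimately show ?thesis
      unfolding g_def g'_def by (intro DERIV_truncated_powr_quotient)
  qed
  obtain t where t: "\<And>i. i < n \<Longrightarrow> u i < t i \<and> t i < u (Suc i)"
    and eq2: "det (mat n n (\<lambda>(i, j). g (Suc j) (u (Suc i)) - g (Suc j) (u i)))
      = (\<Prod>i<n. u (Suc i) - u i) * det (mat n n (\<lambda>(i, j). g' (Suc j) (t i)))"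
    using det_mean_value_rows[of n u "\<lambda>i. u (Suc i)" "\<lambda>k. g (Suc k)" "\<lambda>k. g' (Suc k)"] uSuc der
    by auto
  have "det (mat n n (\<lambda>(i, j). g' (Suc j) (t i))) = det (mat n n (\<lambda>(i, j).
      (\<alpha> * (t i - v 0) powr (- \<alpha> - 1)) * (v (Suc j) - v 0) * max (t i - v (Suc j)) 0 powr (\<alpha> - 1)))"
    unfolding g'_def ..
  also have "\<dots> = (\<Prod>i<n. \<alpha> * (t i - v 0) powr (- \<alpha> - 1)) * (\<Prod>j<n. v (Suc j) - v 0) *
      truncated_powr_det (\<alpha> - 1) n t (\<lambda>j. v (Suc j))"
    by (rule det_scale)
  finally have eq3: "det (mat n n (\<lambda>(i, j). g' (Suc j) (t i)))
      = \<alpha> ^ n * (\<Prod>i<n. (t i - v 0) powr (- \<alpha> - 1)) * (\<Prod>j<n. v (Suc j) - v 0) *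
      truncated_powr_det (\<alpha> - 1) n t (\<lambda>j. v (Suc j))"
    by (simp add: prod.distrib)
  \<comment> \<open>\<open>C\<close> gathers the positive factors: row normalizations, gaps between
    nodes, and row and column factors of the derivatives. The power \<open>\<alpha> ^ n\<close>
    stays outside because its sign is not fixed.\<close>
  define C where "C = (\<Prod>i<Suc n. (u i - v 0) powr \<alpha>) * (\<Prod>i<n. u (Suc i) - u i)
      * (\<Prod>i<n. (t i - v 0) powr (- \<alpha> - 1)) * (\<Prod>j<n. v (Suc j) - v 0)"
  have tpos: "0 < t i - v 0" if "i < n" for i
    using t[OF that] pos[of i] that by linarith
  have "C > 0"
    unfolding C_def
    using pos uSuc tpos strict_mono_onD[OF v, of 0 "Suc _"]
    by (intro mult_pos_pos prod_pos) (fastforce simp: less_Suc_eq_le)+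
  moreover have "t i < t j" if "i < j" "j < n" for i j
  proof -
    have "u (Suc i) \<le> u j"
      using strict_mono_onD[OF u, of "Suc i" j] that by (cases "Suc i = j") auto
    then show ?thesis
      using t[of i] t[of j] that by linarith
  qed
  then have "strict_mono_on {..<n} t"
    by (auto intro: strict_mono_onI)
  moreover have "truncated_powr_det \<alpha> (Suc n) u v
       = C * \<alpha> ^ n * truncated_powr_det (\<alpha> - 1) n t (\<lambda>j. v (Suc j))"
    unfolding eq1 eq2 eq3 C_def by (simp only: mult_ac)
  ultimately show ?thesis
    using that t by blast
qed

section \<open>Signs of determinants with separated nodes\<close>

text \<open>With separated nodes the recursion applies for every real \<alpha>, and each step
  contributes the sign of a power of the current exponent. The factor \<open>i = n - 1\<close> has
  exponent 0 and equals 1 even when its base is 0, as \<open>^\<close> satisfies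
  \<open>0 ^ 0 = 1\<close>, unlike \<open>powr\<close>.\<close>

lemma sgn_truncated_powr_det:
  fixes \<alpha> :: real and u v :: "nat \<Rightarrow> real"
  assumes "strict_mono_on {..<n} u" "strict_mono_on {..<n} v"
    and "\<And>i j. i < n \<Longrightarrow> j < n \<Longrightarrow> v j < u i"
  shows "sgn (truncated_powr_det \<alpha> n u v) = (\<Prod>i<n. sgn (\<alpha> - real i) ^ (n - 1 - i))"
  using assms
proof (induction n arbitrary: \<alpha> u v)
  case 0
  then show ?case by simp
next
  case (Suc n)
  obtain t C where C: "C > 0" and t: "strict_mono_on {..<n} t" "\<And>i. i < n \<Longrightarrow> u i < t i"
    and eq: "truncated_powr_det \<alpha> (Suc n) u v
       = C * \<alpha> ^ n * truncated_powr_det (\<alpha> - 1) n t (\<lambda>j. v (Suc j))"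
    by (rule truncated_powr_det_Suc[OF Suc.prems(1,2), of \<alpha>]) (use Suc.prems(3) in auto)
  have "sgn (truncated_powr_det (\<alpha> - 1) n t (\<lambda>j. v (Suc j)))
      = (\<Prod>i<n. sgn (\<alpha> - 1 - real i) ^ (n - 1 - i))"
  proof (rule Suc.IH[OF t(1)])
    show "strict_mono_on {..<n} (\<lambda>j. v (Suc j))"
      using Suc.prems(2) by (auto simp: strict_mono_on_def)
    show "v (Suc j) < t i" if "i < n" "j < n" for i j
      using t(2)[OF that(1)] Suc.prems(3)[of i "Suc j"] that by simp
  qed
  then have "sgn (truncated_powr_det \<alpha> (Suc n) u v)
      = sgn \<alpha> ^ n * (\<Prod>i<n. sgn (\<alpha> - 1 - real i) ^ (n - 1 - i))"
    unfolding eq using C by (simp add: sgn_mult power_sgn)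
  \<comment> \<open>Peeling off \<open>i = 0\<close> yields \<open>sgn \<alpha> ^ n\<close>; the
    remaining indices shift by one, matching \<alpha> - 1.\<close>
  then show ?case
    unfolding prod.lessThan_Suc_shift by (simp add: diff_diff_eq)
qed

text \<open>The bases with i \<le> n - 2 are positive, and the last factor has exponent 0.\<close>

lemma truncated_powr_det_pos:
  assumes "strict_mono_on {..<n} u" "strict_mono_on {..<n} v"
    and "\<And>i j. i < n \<Longrightarrow> j < n \<Longrightarrow> v j < u i" and "\<alpha> > real n - 2"
  shows "truncated_powr_det \<alpha> n u v > 0"
proof -
  have "sgn (\<alpha> - real i) ^ (n - 1 - i) = 1" if "i < n" for i
    using that assms(4) by (cases "i = n - 1") auto
  then have "sgn (truncated_powr_det \<alpha> n u v) = 1"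
    using sgn_truncated_powr_det[OF assms(1-3), of \<alpha>] by simp
  then show ?thesis by (simp add: sgn_1_pos)
qed

text \<open>For \<open>k < n - 1\<close> the factor \<open>i = k\<close> vanishes with positive
  exponent, so the determinant is 0; for larger \<open>k\<close> it is positive.\<close>

lemma truncated_powr_det_of_nat_nonneg:
  assumes "strict_mono_on {..<n} u" "strict_mono_on {..<n} v"
    and "\<And>i j. i < n \<Longrightarrow> j < n \<Longrightarrow> v j < u i"
  shows "truncated_powr_det (real k) n u v \<ge> 0"
proof (cases "k < n - 1")
  case True
  then have "\<exists>i\<in>{..<n}. sgn (real k - real i) ^ (n - 1 - i) = 0"
    by (intro bexI[of _ k]) auto
  then have "sgn (truncated_powr_det (real k) n u v) = 0"
    using sgn_truncated_powr_det[OF assms, of "real k"] by simp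
  then show ?thesis by (simp add: sgn_0_0)
next
  case False
  then show ?thesis
    using truncated_powr_det_pos[OF assms, of "real k"] by fastforce
qed

text \<open>In order m + 3 the base is negative for i = m + 1, with exponent 1, and for i = m + 2,
  with exponent 0. Exactly one factor is therefore -1.\<close>

lemma truncated_powr_det_neg:
  assumes "strict_mono_on {..<m + 3} u" "strict_mono_on {..<m + 3} v"
    and "\<And>i j. i < m + 3 \<Longrightarrow> j < m + 3 \<Longrightarrow> v j < u i"
    and "real m < \<alpha>" "\<alpha> < real m + 1"
  shows "truncated_powr_det \<alpha> (m + 3) u v < 0"
proof -
  have *: "sgn (\<alpha> - real i) ^ (m + 2 - i) = (if i = m + 1 then - 1 else 1)" if "i < m + 3" for i
  proof -
    have "i \<le> m \<or> i = m + 1 \<or> i = m + 2"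
      using that by arith
    then show ?thesis
      using assms(4,5) by (elim disjE) auto
  qed
  have "(\<Prod>i<m + 3. sgn (\<alpha> - real i) ^ (m + 2 - i)) = (\<Prod>i<m + 3. if i = m + 1 then - 1 else 1)"
    by (intro prod.cong) (use * in auto)
  then have "sgn (truncated_powr_det \<alpha> (m + 3) u v) = - 1"
    using sgn_truncated_powr_det[OF assms(1-3), of \<alpha>] by (simp add: prod.delta)
  then show ?thesis by (simp add: sgn_1_neg)
qed

section \<open>Nonnegativity without separation\<close>

text \<open>Exponents in [0, 1] are out of reach of the recursion without separation. Here the
  products of the two diagonals are compared for exponent 1 and then raised to the power \<alpha>.
  If \<open>v 1 < u 0\<close> they differ by (u 1 - u 0) (v 1 - v 0); otherwise the smaller one is
  0.\<close>

lemma truncated_powr_det_2_nonneg: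
  fixes u v :: "nat \<Rightarrow> real"
  assumes "u 0 < u 1" "v 0 < v 1" "\<alpha> \<ge> 0"
  shows "truncated_powr_det \<alpha> 2 u v \<ge> 0"
proof -
  have "max (u 0 - v 1) 0 * max (u 1 - v 0) 0 \<le> max (u 0 - v 0) 0 * max (u 1 - v 1) 0"
  proof (cases "v 1 < u 0")
    case True
    have "0 \<le> (u 1 - u 0) * (v 1 - v 0)"
      using assms by simp
    then show ?thesis
      using True assms by (simp add: max_def algebra_simps)
  qed simp
  then have "(max (u 0 - v 1) 0 * max (u 1 - v 0) 0) powr \<alpha>
      \<le> (max (u 0 - v 0) 0 * max (u 1 - v 1) 0) powr \<alpha>"
    using assms(3) by (intro powr_mono2) auto
  then show ?thesis
    by (subst laplace_expansion_row[of _ 2 0])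
       (auto simp: powr_mult cofactor_def mat_delete_def det_single numeral_2_eq_2)
qed

lemma truncated_powr_det_nonneg_strict:
  fixes \<alpha> :: real and u v :: "nat \<Rightarrow> real"
  assumes "strict_mono_on {..<n} u" "strict_mono_on {..<n} v" "\<alpha> > real n - 2"
  shows "truncated_powr_det \<alpha> n u v \<ge> 0"
  using assms
proof (induction n arbitrary: \<alpha> u v)
  case 0
  then show ?case by simp
next
  case (Suc n)
  \<comment> \<open>The order is \<open>Suc n\<close>. For n \<ge> 2 the hypothesis gives \<alpha> >
    1, as the recursion requires; it needs \<open>v 0 < u 0\<close> too, and otherwise the first row
    is zero.\<close>
  consider "n = 0" | "n = 1" | "n \<ge> 2" "u 0 \<le> v 0" | "n \<ge> 2" "v 0 < u 0"
    by linarith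
  then show ?case
  proof cases
    case 1
    then show ?thesis by (simp add: det_single)
  next
    case 2
    then show ?thesis
      using truncated_powr_det_2_nonneg[of u v \<alpha>] Suc.prems
      by (simp add: numeral_2_eq_2 strict_mono_onD)
  next
    case 3
    have "u 0 \<le> v j" if "j < Suc n" for j
      using strict_mono_onD[OF Suc.prems(2), of 0 j] 3 that by (cases "j = 0") auto
    then have "truncated_powr_det \<alpha> (Suc n) u v = 0"
      by (subst laplace_expansion_row[of _ "Suc n" 0]) (auto simp: max_def intro!: sum.neutral)
    then show ?thesis by simp
  next
    case 4
    then have \<alpha>: "\<alpha> > 1"
      using Suc.prems(3) by simp
    then obtain t C where C: "C > 0" and t: "strict_mono_on {..<n} t"
      and eq: "truncated_powr_det \<alpha> (Suc n) u v
         = C * \<alpha> ^ n * truncated_powr_det (\<alpha> - 1) n t (\<lambda>j. v (Suc j))"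
      using truncated_powr_det_Suc[OF Suc.prems(1,2), of \<alpha>] 4 by blast
    have "strict_mono_on {..<n} (\<lambda>j. v (Suc j))"
      using Suc.prems(2) by (auto simp: strict_mono_on_def)
    then have "truncated_powr_det (\<alpha> - 1) n t (\<lambda>j. v (Suc j)) \<ge> 0"
      using Suc.IH[OF t, of "\<lambda>j. v (Suc j)" "\<alpha> - 1"] Suc.prems(3) by simp
    then show ?thesis
      unfolding eq using C \<alpha> by simp
  qed
qed

lemma truncated_powr_det_nonneg:
  fixes \<alpha> :: real and u v :: "nat \<Rightarrow> real"
  assumes "strict_mono_on {..<n} u" "strict_mono_on {..<n} v" "\<alpha> \<ge> real n - 2"
  shows "truncated_powr_det \<alpha> n u v \<ge> 0"
proof (rule tendsto_lowerbound)
  \<comment> \<open>Entries are continuous in the exponent, also at base 0, where they are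
    constantly 0. The strict case thus passes to the limit from the right.\<close>
  have *: "((\<lambda>\<beta>. c powr \<beta>) \<longlongrightarrow> c powr \<alpha>) (at_right \<alpha>)" for c :: real
    by (cases "c = 0") (auto intro!: tendsto_intros)
  then show "((\<lambda>\<beta>. truncated_powr_det \<beta> n u v) \<longlongrightarrow> truncated_powr_det \<alpha> n u v) (at_right \<alpha>)"
    unfolding det_def'[OF mat_carrier]
    by (intro tendsto_sum tendsto_mult tendsto_const tendsto_prod)
       (auto simp: permutes_in_image[where S = "{0..<n}", simplified] intro: *)
  show "\<forall>\<^sub>F \<beta> in at_right \<alpha>. 0 \<le> truncated_powr_det \<beta> n u v"
    using eventually_at_right_less[of \<alpha>]
    by eventually_elim (use assms in \<open>auto intro!: truncated_powr_det_nonneg_strict\<close>)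
qed simp

section \<open>Reduction of \<open>Omega\<close> to truncated powers\<close>

lemma Omega_factorization:
  assumes "q > 0" "r > 0"
  obtains f c where "strict_mono f" "c > 0"
    "\<And>s t. Omega q r (s - t) = c * exp (- q * s) * exp (r * t) * max (f s - f t) 0"
proof (cases "q = r")
  case True
  have "exp (- r * (s - t)) = exp (- r * s) * exp (r * t)" for s t
    by (simp add: algebra_simps flip: exp_add)
  then show ?thesis
    by (intro that[of "\<lambda>x. x" "r ^ 2"])
       (use assms True in \<open>auto simp: Omega_def strict_mono_def max_def\<close>)
next
  case False
  \<comment> \<open>An antiderivative of \<open>exp (- (r - q) * s)\<close>, hence increasing
    whichever of \<open>q\<close>, \<open>r\<close> is larger. For q = r the integrand is 1,
    matching the identity used above.\<close>
  define f where "f s = - exp (- (r - q) * s) / (r - q)" for s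
  have f: "f s < f t" if "s < t" for s t
  proof (cases "q < r")
    case True
    then show ?thesis
      using that by (simp add: f_def divide_strict_right_mono)
  next
    case False
    with \<open>q \<noteq> r\<close> have "r < q" by simp
    then show ?thesis
      using that by (simp add: f_def divide_strict_right_mono_neg)
  qed
  have *: "exp (- q * (s - t)) - exp (- r * (s - t)) = (r - q) * (exp (- q * s) * exp (r * t) * (f s - f t))"
    for s t
  proof -
    have 1: "(r - q) * (f s - f t) = exp (- (r - q) * t) - exp (- (r - q) * s)"
      using False by (simp add: f_def right_diff_distrib)
    have 2: "exp (- q * (s - t)) = exp (- q * s) * exp (r * t) * exp (- (r - q) * t)"
      and 3: "exp (- r * (s - t)) = exp (- q * s) * exp (r * t) * exp (- (r - q) * s)"
      by (simp_all add: algebra_simps flip: exp_add)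
    have "exp (- q * (s - t)) - exp (- r * (s - t))
        = exp (- q * s) * exp (r * t) * ((r - q) * (f s - f t))"
      unfolding 1 2 3 by (rule right_diff_distrib[symmetric])
    then show ?thesis by simp
  qed
  show ?thesis
  proof (rule that[of f "q * r"])
    show "strict_mono f"
      using f by (simp add: strict_mono_def)
    fix s t
    show "Omega q r (s - t) = q * r * exp (- q * s) * exp (r * t) * max (f s - f t) 0"
    proof (cases "t < s")
      case True
      then show ?thesis
        using False f[of t s] unfolding Omega_def * by (simp add: max_def)
    next
      case ts: False
      then have "f s \<le> f t"
        using f[of s t] by (cases "s = t") auto
      with ts show ?thesis
        by (simp add: Omega_def max_def)
    qed
  qed (use assms in auto)
qed

text \<open>The nodes are \<open>f (xs ! i)\<close> and \<open>f (ys ! j + a)\<close>, so the shift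
  is absorbed into the second family. The exponential factors are positive and leave the determinant
  through its rows and columns.\<close>

lemma det_kmat_Omega:
  assumes "q > 0" "r > 0" and xs: "xs \<in> inc UNIV n" and ys: "ys \<in> inc UNIV n"
  obtains C u v where "C > 0" "strict_mono_on {..<n} u" "strict_mono_on {..<n} v"
    "det (kmat (\<lambda>x y. Omega q r (x - y - a) powr \<alpha>) xs ys) = C * truncated_powr_det \<alpha> n u v"
    "\<And>i j. \<lbrakk>i < n; j < n; ys ! j + a < xs ! i\<rbrakk> \<Longrightarrow> v j < u i"
proof -
  obtain f c where f: "strict_mono f" and c: "c > 0"
    and eq: "\<And>s t. Omega q r (s - t) = c * exp (- q * s) * exp (r * t) * max (f s - f t) 0"
    using Omega_factorization[OF assms(1,2)] by blast
  have eq': "Omega q r (x - y - a) powr \<alpha> = (c * exp (- q * x)) powr \<alpha> * exp (r * (y + a)) powr \<alpha> *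
      max (f x - f (y + a)) 0 powr \<alpha>" for x y
    using eq[of x "y + a"] by (simp add: powr_mult algebra_simps)
  have len: "length xs = n" "length ys = n"
    using xs ys by (auto simp: inc_def)
  have "kmat (\<lambda>x y. Omega q r (x - y - a) powr \<alpha>) xs ys = mat n n (\<lambda>(i, j).
      (c * exp (- q * xs ! i)) powr \<alpha> * exp (r * (ys ! j + a)) powr \<alpha> *
      max (f (xs ! i) - f (ys ! j + a)) 0 powr \<alpha>)"
    unfolding kmat_def len eq' ..
  moreover have "(\<Prod>i<n. (c * exp (- q * xs ! i)) powr \<alpha>) * (\<Prod>j<n. exp (r * (ys ! j + a)) powr \<alpha>) > 0"
    using c by (intro mult_pos_pos prod_pos) auto
  moreover have "strict_mono_on {..<n} (\<lambda>i. f (xs ! i))" "strict_mono_on {..<n} (\<lambda>j. f (ys ! j + a))"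
    using xs ys f by (auto simp: inc_def sorted_wrt_iff_nth_less strict_mono_less intro!: strict_mono_onI)
  ultimately show ?thesis
    using f that[of _ "\<lambda>i. f (xs ! i)" "\<lambda>j. f (ys ! j + a)"] by (simp add: det_scale strict_mono_less)
qed

section \<open>Minors of kernel matrices\<close>

lemma index_lists_le:
  assumes "is \<in> index_lists p n"
  shows "n \<le> p"
proof -
  have "distinct is"
    using assms by (auto simp: index_lists_def strict_sorted_iff)
  then have "n = card (set is)"
    using assms by (simp add: distinct_card index_lists_def)
  also have "\<dots> \<le> card {..<p}"
    using assms by (intro card_mono) (auto simp: index_lists_def)
  finally show ?thesis by simp
qed

lemma index_lists_nth_less:
  assumes "is \<in> index_lists p n" "i < n"
  shows "is ! i < p"
  using assms nth_mem[of i "is"] by (auto simp: index_lists_def simp del: nth_mem)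

lemma map_nth_in_inc:
  assumes "xs \<in> inc X p" "is \<in> index_lists p n"
  shows "map ((!) xs) is \<in> inc X n"
proof -
  have "xs ! (is ! i) \<in> X" if "i < n" for i
    using assms index_lists_nth_less[OF assms(2) that] nth_mem[of "is ! i" xs]
    by (auto simp: inc_def)
  moreover have "xs ! (is ! i) < xs ! (is ! j)" if "i < j" "j < n" for i j
    using assms index_lists_nth_less[OF assms(2) that(2)] that
    by (auto simp: inc_def index_lists_def sorted_wrt_iff_nth_less)
  ultimately show ?thesis
    using assms(2) by (auto simp: inc_def index_lists_def sorted_wrt_iff_nth_less set_conv_nth)
qed

lemma minor_kmat:
  assumes "xs \<in> inc X p" "is \<in> index_lists p n" "ys \<in> inc Y p" "js \<in> index_lists p n"
  shows "minor (kmat K xs ys) is js = det (kmat K (map ((!) xs) is) (map ((!) ys) js))"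
proof -
  have "is ! i < p" "js ! i < p" if "i < n" for i
    using assms(2,4) that by (auto intro: index_lists_nth_less)
  then show ?thesis
    using assms unfolding minor_def
    by (intro arg_cong[of _ _ det] eq_matI) (auto simp: kmat_def inc_def index_lists_def)
qed

text \<open>Minors of a kernel matrix are kernel determinants at subtuples. Read contrapositively,
  one bad matrix refutes the kernel.\<close>

lemma TN_kernel_imp_TN_mat:
  assumes "TN_kernel p K X Y" "xs \<in> inc X p" "ys \<in> inc Y p"
  shows "TN_mat (kmat K xs ys)"
proof -
  have dim: "dim_row (kmat K xs ys) = p" "dim_col (kmat K xs ys) = p"
    using assms(2,3) by (auto simp: kmat_def inc_def)
  show ?thesis
    unfolding TN_mat_def dim
  proof (intro allI impI ballI)
    fix n "is" js
    assume n: "1 \<le> n" and "is": "is \<in> index_lists p n" and js: "js \<in> index_lists p n"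
    \<comment> \<open>\<open>TN_mat\<close> ranges over all orders, but no increasing index list in
      \<open>{..<p}\<close> is longer than \<open>p\<close>.\<close>
    have "n \<in> {1..p}"
      using index_lists_le[OF "is"] n by simp
    then show "0 \<le> minor (kmat K xs ys) is js"
      using assms(1) map_nth_in_inc[OF assms(2) "is"] map_nth_in_inc[OF assms(3) js]
      unfolding TN_kernel_def minor_kmat[OF assms(2) "is" assms(3) js] by blast
  qed
qed

text \<open>The disjunction expresses size at least \<open>p\<close>, since \<open>card\<close> is 0
  on infinite sets.\<close>

lemma inc_nonempty:
  assumes "infinite X \<or> p \<le> card X"
  obtains xs where "xs \<in> inc X p"
proof -
  obtain S where S: "S \<subseteq> X" "finite S" "card S = p"
    using assms infinite_arbitrarily_large[of X p] obtain_subset_with_card_n[of p X] by metis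
  then have "sorted_list_of_set S \<in> inc X p"
    by (auto simp: inc_def)
  then show ?thesis using that by blast
qed

section \<open>The three assertions about powers of \<open>Omega\<close>\<close>

lemma TN_kernel_Omega:
  assumes "q > 0" "r > 0" "\<alpha> \<ge> real p - 2"
  shows "TN_kernel p (\<lambda>x y. Omega q r (x - y) powr \<alpha>) X Y"
  unfolding TN_kernel_def
proof (intro ballI)
  fix n xs ys
  assume n: "n \<in> {1..p}" and "xs \<in> inc X n" "ys \<in> inc Y n"
  then have "xs \<in> inc UNIV n" "ys \<in> inc UNIV n"
    by (auto simp: inc_def)
  from det_kmat_Omega[OF assms(1,2) this] obtain C u v where "C > 0"
    "strict_mono_on {..<n} u" "strict_mono_on {..<n} v"
    "det (kmat (\<lambda>x y. Omega q r (x - y - 0) powr \<alpha>) xs ys) = C * truncated_powr_det \<alpha> n u v"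
    by metis
  then show "0 \<le> det (kmat (\<lambda>x y. Omega q r (x - y) powr \<alpha>) xs ys)"
    using truncated_powr_det_nonneg[of n u v \<alpha>] n assms(3) by simp
qed

text \<open>Separation by \<open>a\<close> does not involve \<alpha>, so a single shift serves all
  exponents. Every minor then becomes a positive multiple of a determinant with separated
  nodes.\<close>

lemma Omega_powr_matrix:
  assumes "q > 0" "r > 0" and xs: "xs \<in> inc UNIV p" and ys: "ys \<in> inc UNIV p"
    and sep: "\<And>x y. \<lbrakk>x \<in> set xs; y \<in> set ys\<rbrakk> \<Longrightarrow> y + a < x"
  defines "M \<equiv> \<lambda>\<alpha>. kmat (\<lambda>x y. Omega q r (x - y - a) powr \<alpha>) xs ys"
  shows "\<alpha> > real p - 2 \<Longrightarrow> TP_mat (M \<alpha>)"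
    and "TN_mat (M (real k))"
    and "\<lbrakk>0 < \<alpha>; \<alpha> < real p - 2; \<alpha> \<notin> \<int>\<rbrakk> \<Longrightarrow> \<not> TN_mat (M \<alpha>)"
proof -
  have dim: "dim_row (M \<alpha>) = p" "dim_col (M \<alpha>) = p" for \<alpha>
    using xs ys by (auto simp: M_def kmat_def inc_def)
  have red: "\<exists>C u v. C > 0 \<and> strict_mono_on {..<n} u \<and> strict_mono_on {..<n} v \<and>
      (\<forall>i j. i < n \<longrightarrow> j < n \<longrightarrow> v j < u i) \<and> minor (M \<alpha>) is js = C * truncated_powr_det \<alpha> n u v"
    if "is": "is \<in> index_lists p n" and js: "js \<in> index_lists p n" for n "is" js \<alpha>
  proof -
    have xs': "map ((!) xs) is \<in> inc UNIV n" and ys': "map ((!) ys) js \<in> inc UNIV n"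
      using map_nth_in_inc xs ys that by blast+
    have "map ((!) ys) js ! j + a < map ((!) xs) is ! i" if "i < n" "j < n" for i j
    proof (rule sep)
      show "map ((!) xs) is ! i \<in> set xs" "map ((!) ys) js ! j \<in> set ys"
        using that xs ys index_lists_nth_less[OF "is", of i] index_lists_nth_less[OF js, of j] "is" js
        by (auto simp: index_lists_def inc_def)
    qed
    with det_kmat_Omega[OF assms(1,2) xs' ys', of a \<alpha>] show ?thesis
      unfolding M_def minor_kmat[OF xs "is" ys js] by metis
  qed
  show "TP_mat (M \<alpha>)" if "\<alpha> > real p - 2"
    unfolding TP_mat_def dim
  proof (intro allI impI ballI)
    fix n "is" js
    assume "is": "is \<in> index_lists p n" and js: "js \<in> index_lists p n"
    have "\<alpha> > real n - 2"
      using index_lists_le[OF "is"] that by simp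
    moreover obtain C u v where "C > 0" "strict_mono_on {..<n} u" "strict_mono_on {..<n} v"
      "\<And>i j. \<lbrakk>i < n; j < n\<rbrakk> \<Longrightarrow> v j < u i" "minor (M \<alpha>) is js = C * truncated_powr_det \<alpha> n u v"
      using red[OF "is" js, of \<alpha>] by blast
    ultimately show "0 < minor (M \<alpha>) is js"
      using truncated_powr_det_pos[of n u v \<alpha>] by simp
  qed
  show "TN_mat (M (real k))"
    unfolding TN_mat_def dim
    using red[where ?\<alpha> = "real k"] truncated_powr_det_of_nat_nonneg by fastforce
  show "\<not> TN_mat (M \<alpha>)" if "0 < \<alpha>" "\<alpha> < real p - 2" "\<alpha> \<notin> \<int>"
  proof -
    \<comment> \<open>From m < \<alpha> < p - 2 follows m + 3 \<le> p, so the leading minor of order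
      m + 3 exists; it is negative.\<close>
    define m where "m = nat \<lfloor>\<alpha>\<rfloor>"
    have m: "real m \<le> \<alpha>" "\<alpha> < real m + 1"
      using that(1) by (auto simp: m_def)
    have "real m \<noteq> \<alpha>"
      using that(3) by auto
    with m have m': "real m < \<alpha>" by simp
    have "m + 3 \<le> p"
      using m' that(2) by linarith
    then have idx: "[0..<m + 3] \<in> index_lists p (m + 3)"
      by (auto simp: index_lists_def)
    have "minor (M \<alpha>) [0..<m + 3] [0..<m + 3] < 0"
      using red[OF idx idx, of \<alpha>] truncated_powr_det_neg[OF _ _ _ m' m(2)]
      by (auto simp: mult_less_0_iff simp del: upt_Suc)
    then show ?thesis
      unfolding TN_mat_def dim using idx by (meson le_add2 not_le one_le_numeral order_trans)
  qed
qed

lemma separating_shift: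
  fixes xs ys :: "real list"
  obtains a where "\<And>x y. \<lbrakk>x \<in> set xs; y \<in> set ys\<rbrakk> \<Longrightarrow> y + a < x"
proof
  fix x y
  assume "x \<in> set xs" "y \<in> set ys"
  then have "Min (set xs) \<le> x" "y \<le> Max (set ys)"
    by simp_all
  \<comment> \<open>The witness moves the largest entry of \<open>ys\<close> to one unit below the
    smallest entry of \<open>xs\<close>.\<close>
  then show "y + (Min (set xs) - Max (set ys) - 1) < x"
    by linarith
qed

theorem mainTheorem10:
  fixes p :: nat and X Y :: "real set" and q r :: real
  assumes hp: "p \<ge> 2"
    and hX: "infinite X \<or> p \<le> card X"
    and hY: "infinite Y \<or> p \<le> card Y"
    and hq: "q > 0" and hr: "r > 0"
  shows
    "(\<forall>\<alpha>::real. \<alpha> \<ge> real p - 2 \<longrightarrow>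
        TN_kernel p (\<lambda>x y. Omega q r (x - y) powr \<alpha>) X Y)
   \<and> (\<exists>a::real. \<forall>\<alpha>::real. \<alpha> \<in> {0<..<real p - 2} \<and> \<alpha> \<notin> \<int> \<longrightarrow>
        \<not> TN_kernel p (\<lambda>x y. Omega q r (x - y - a) powr \<alpha>) X Y)
   \<and> (\<forall>xs\<in>inc UNIV p. \<forall>ys\<in>inc UNIV p. \<exists>a::real. \<forall>\<alpha>::real. \<alpha> \<ge> 0 \<longrightarrow>
        (let M = kmat (\<lambda>x y. Omega q r (x - y - a) powr \<alpha>) xs ys in
          (\<alpha> > real p - 2 \<longrightarrow> TP_mat M)
        \<and> ((\<exists>k::nat. k \<le> p - 2 \<and> \<alpha> = real k) \<longrightarrow> TN_mat M)
        \<and> (\<alpha> \<in> {0<..<real p - 2} \<and> \<alpha> \<notin> \<int> \<longrightarrow> \<not> TN_mat M)))"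
proof (intro conjI)
  show "\<forall>\<alpha>::real. \<alpha> \<ge> real p - 2 \<longrightarrow> TN_kernel p (\<lambda>x y. Omega q r (x - y) powr \<alpha>) X Y"
    using TN_kernel_Omega[OF hq hr] by blast
  \<comment> \<open>One pair of tuples, fixed before \<alpha>, determines a shift that refutes the
    kernel for all exponents at once.\<close>
  obtain xs ys where xs: "xs \<in> inc X p" and ys: "ys \<in> inc Y p"
    using inc_nonempty[OF hX] inc_nonempty[OF hY] by metis
  then have "xs \<in> inc UNIV p" "ys \<in> inc UNIV p"
    by (auto simp: inc_def)
  moreover obtain a where "\<And>x y. \<lbrakk>x \<in> set xs; y \<in> set ys\<rbrakk> \<Longrightarrow> y + a < x"
    using separating_shift by blast
  ultimately have "\<not> TN_mat (kmat (\<lambda>x y. Omega q r (x - y - a) powr \<alpha>) xs ys)"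
    if "0 < \<alpha>" "\<alpha> < real p - 2" "\<alpha> \<notin> \<int>" for \<alpha>
    using Omega_powr_matrix(3)[OF hq hr] that by blast
  then show "\<exists>a::real. \<forall>\<alpha>::real. \<alpha> \<in> {0<..<real p - 2} \<and> \<alpha> \<notin> \<int> \<longrightarrow>
        \<not> TN_kernel p (\<lambda>x y. Omega q r (x - y - a) powr \<alpha>) X Y"
    using TN_kernel_imp_TN_mat[OF _ xs ys] by (intro exI[of _ a]) auto
  show "\<forall>xs\<in>inc UNIV p. \<forall>ys\<in>inc UNIV p. \<exists>a::real. \<forall>\<alpha>::real. \<alpha> \<ge> 0 \<longrightarrow>
        (let M = kmat (\<lambda>x y. Omega q r (x - y - a) powr \<alpha>) xs ys in
          (\<alpha> > real p - 2 \<longrightarrow> TP_mat M)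
        \<and> ((\<exists>k::nat. k \<le> p - 2 \<and> \<alpha> = real k) \<longrightarrow> TN_mat M)
        \<and> (\<alpha> \<in> {0<..<real p - 2} \<and> \<alpha> \<notin> \<int> \<longrightarrow> \<not> TN_mat M))"
  proof (intro ballI)
    fix xs ys
    assume xs: "xs \<in> inc UNIV p" and ys: "ys \<in> inc UNIV p"
    obtain a where "\<And>x y. \<lbrakk>x \<in> set xs; y \<in> set ys\<rbrakk> \<Longrightarrow> y + a < x"
      using separating_shift by blast
    note M = Omega_powr_matrix[OF hq hr xs ys this]
    show "\<exists>a::real. \<forall>\<alpha>::real. \<alpha> \<ge> 0 \<longrightarrow>
        (let M = kmat (\<lambda>x y. Omega q r (x - y - a) powr \<alpha>) xs ys in
          (\<alpha> > real p - 2 \<longrightarrow> TP_mat M)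
        \<and> ((\<exists>k::nat. k \<le> p - 2 \<and> \<alpha> = real k) \<longrightarrow> TN_mat M)
        \<and> (\<alpha> \<in> {0<..<real p - 2} \<and> \<alpha> \<notin> \<int> \<longrightarrow> \<not> TN_mat M))"
      unfolding Let_def using M by (intro exI[of _ a]) auto
  qed
qed

end
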